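(* Let $n,m\in\mathbb{N}$, $F\in\mathbb{R}^{n\times n}$, $x_0\in\mathbb{R}^n$, $\alpha,\beta\in\mathbb{R}$ and $h>0$ be such that $I_n-h\alpha F$ is nonsingular. Suppose that the sequence $x_0,\ldots,x_m\in\mathbb{R}^n$ is generated from $\dot x(t)=Fx(t)$, $x(0)=x_0$, via the $1$-stage Runge-Kutta method $(\alpha,\beta)$ with step size $h$, i.e. $x_{i+1}=A_hx_i$ for $i=0,\ldots,m-1$ with $$A_h=I_n+h\beta(I_n-h\alpha F)^{-1}F.$$ Let $A_{\mathrm{DMD}}\in\mathbb{R}^{n\times n}$ be the associated DMD matrix. If $\operatorname{rank}([x_0\ \cdots\ x_{m-1}])=n$, then $$F=-\frac1h\,(I_n-A_{\mathrm{DMD}})\left(\alpha A_{\mathrm{DMD}}+(\beta-\alpha)I_n\right)^{-1},$$ provided the inverse exists.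
   Context: For data $x_0,\ldots,x_m\in\mathbb{R}^n$ with $X=[x_0\ \cdots\ x_{m-1}]$ and $Z=[x_1\ \cdots\ x_m]$, the DMD (dynamic mode decomposition) matrix is $A_{\mathrm{DMD}}=ZX^\dagger$, where $X^\dagger$ denotes the Moore-Penrose pseudoinverse of $X$. *)

theory Defs
  imports "Jordan_Normal_Form.DL_Rank" "Jordan_Normal_Form.Gauss_Jordan_Elimination"
begin

text \<open>For a square matrix that is not invertible, \<^const>\<open>mat_inverse\<close> is \<^const>\<open>None\<close> and
  the following value is unspecified.\<close>

definition mat_inv :: "real mat \<Rightarrow> real mat" where
  "mat_inv A = the (mat_inverse A)"

lemma mat_inv:
  assumes A: "A \<in> carrier_mat n n" and inv: "invertible_mat A"
  shows "mat_inv A \<in> carrier_mat n n" "A * mat_inv A = 1\<^sub>m n" "mat_inv A * A = 1\<^sub>m n"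
proof -
  from inv obtain B where B: "A * B = 1\<^sub>m (dim_row A)" "B * A = 1\<^sub>m (dim_row B)"
    by (auto simp: invertible_mat_def inverts_mat_def)
  have "dim_col B = n" "dim_row B = n"
    using A arg_cong[OF B(1), of dim_col] arg_cong[OF B(2), of dim_col] by auto
  with A B have "A \<in> Units (ring_mat TYPE(real) n ())"
    by (auto simp: Units_def ring_mat_def intro!: bexI[of _ B])
  then obtain C where C: "mat_inverse A = Some C"
    using mat_inverse(1)[OF A, where b = "()"] by (cases "mat_inverse A") auto
  from mat_inverse(2)[OF A C] C
  show "mat_inv A \<in> carrier_mat n n" "A * mat_inv A = 1\<^sub>m n" "mat_inv A * A = 1\<^sub>m n"
    by (auto simp: mat_inv_def)
qed

text \<open>The four Penrose conditions; over the reals the adjoint is the transpose.\<close>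

definition is_pseudoinverse :: "real mat \<Rightarrow> real mat \<Rightarrow> bool" where
  "is_pseudoinverse A B \<longleftrightarrow>
     B \<in> carrier_mat (dim_col A) (dim_row A) \<and>
     A * B * A = A \<and>
     B * A * B = B \<and>
     transpose_mat (A * B) = A * B \<and>
     transpose_mat (B * A) = B * A"

lemma is_pseudoinverse_unique:
  assumes "is_pseudoinverse A B" and "is_pseudoinverse A C"
  shows "B = C"
proof -
  define r c where "r = dim_row A" and "c = dim_col A"
  have A: "A \<in> carrier_mat r c" by (auto simp: r_def c_def)
  have B: "B \<in> carrier_mat c r" and C: "C \<in> carrier_mat c r"
    using assms by (auto simp: is_pseudoinverse_def r_def c_def)
  have AB: "A * B \<in> carrier_mat r r" and AC: "A * C \<in> carrier_mat r r"
    and BA: "B * A \<in> carrier_mat c c" and CA: "C * A \<in> carrier_mat c c"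
    using A B C by auto
  have pB: "A * B * A = A" "B * A * B = B" "transpose_mat (A * B) = A * B"
      "transpose_mat (B * A) = B * A"
    and pC: "A * C * A = A" "C * A * C = C" "transpose_mat (A * C) = A * C"
      "transpose_mat (C * A) = C * A"
    using assms by (auto simp: is_pseudoinverse_def)
  have "A * B = (A * C) * (A * B)"
    using pC(1) assoc_mult_mat[OF AC A B] by simp
  also have "\<dots> = transpose_mat ((A * B) * (A * C))"
    using transpose_mult[OF AB AC] pB pC by simp
  also have "(A * B) * (A * C) = A * C"
    using pB(1) assoc_mult_mat[OF AB A C] by simp
  finally have 1: "A * B = A * C" using pC by simp
  have "B * A = (B * A) * (C * A)"
    using pC(1) A C assoc_mult_mat[OF B A CA] assoc_mult_mat[OF A C A] by simp
  also have "\<dots> = transpose_mat ((C * A) * (B * A))"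
    using transpose_mult[OF CA BA] pB pC by simp
  also have "(C * A) * (B * A) = C * A"
    using pB(1) assoc_mult_mat[OF C A BA] assoc_mult_mat[OF A B A] by simp
  finally have 2: "B * A = C * A" using pC by simp
  have "B = (B * A) * B" using pB by simp
  also have "\<dots> = C * (A * C)" using 1 2 assoc_mult_mat[OF C A B] by simp
  also have "\<dots> = C" using pC assoc_mult_mat[OF C A C] by simp
  finally show ?thesis .
qed

definition pseudoinverse :: "real mat \<Rightarrow> real mat" where
  "pseudoinverse A = (THE B. is_pseudoinverse A B)"

text \<open>The matrices \<open>X\<close> and \<open>Z\<close>; only the values of \<open>x\<close> at indices up to \<open>m\<close> matter.\<close>

definition data_matrix :: "nat \<Rightarrow> nat \<Rightarrow> (nat \<Rightarrow> real vec) \<Rightarrow> real mat" where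
  "data_matrix n m x = mat_of_cols n (map x [0..<m])"

definition shifted_data_matrix :: "nat \<Rightarrow> nat \<Rightarrow> (nat \<Rightarrow> real vec) \<Rightarrow> real mat" where
  "shifted_data_matrix n m x = mat_of_cols n (map x [1..<m+1])"

definition dmd_matrix :: "nat \<Rightarrow> nat \<Rightarrow> (nat \<Rightarrow> real vec) \<Rightarrow> real mat" where
  "dmd_matrix n m x = shifted_data_matrix n m x * pseudoinverse (data_matrix n m x)"

text \<open>One step of the 1-stage Runge-Kutta method \<open>(\<alpha>, \<beta>)\<close> for \<open>x' = F x\<close>: the stage
  equation \<open>k = F (x + h \<alpha> k)\<close> gives \<open>k = (I - h \<alpha> F)\<^sup>-\<^sup>1 F x\<close>, and
  \<open>x + h \<beta> k\<close> is the new value.\<close>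

definition rk1_matrix :: "nat \<Rightarrow> real \<Rightarrow> real \<Rightarrow> real \<Rightarrow> real mat \<Rightarrow> real mat" where
  "rk1_matrix n h \<alpha> \<beta> F =
     1\<^sub>m n + (h * \<beta>) \<cdot>\<^sub>m (mat_inv (1\<^sub>m n - (h * \<alpha>) \<cdot>\<^sub>m F) * F)"

end

theory Submission
  imports Defs
begin

text \<open>
  Write \<open>X\<close> and \<open>Z\<close> for the data matrix and the shifted data matrix, \<open>A\<close> for the Runge-Kutta
  matrix, and \<open>G = (I - h \<alpha> F)\<^sup>-\<^sup>1\<close>, so that \<open>A = I + h \<beta> G F\<close>.

  The recursion says \<open>Z = A X\<close>. Since \<open>X\<close> has full row rank, its Gram matrix \<open>X X\<^sup>T\<close> is invertible
  and \<open>X\<^sup>T (X X\<^sup>T)\<^sup>-\<^sup>1\<close> is the pseudoinverse of \<open>X\<close>. The pseudoinverse is thus a right inverse, and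
  \<open>A\<^sub>D\<^sub>M\<^sub>D = Z X\<^sup>\<dagger> = A X X\<^sup>\<dagger> = A\<close>: the data determine the one-step matrix, whichever linear
  one-step method produced them (\<open>dmd_matrix_eq_one_step_matrix\<close>).

  It remains to recover \<open>F\<close> from \<open>A\<close> (\<open>rk1_matrix_identities\<close>). The matrix \<open>F\<close> commutes with
  \<open>I - h \<alpha> F\<close>, hence with \<open>G\<close>, and \<open>G (I - h \<alpha> F) = I\<close> reads \<open>I + h \<alpha> G F = G\<close>. Therefore the matrix to be
  inverted is \<open>\<alpha> A + (\<beta> - \<alpha>) I = \<beta> (I + h \<alpha> G F) = \<beta> G\<close>, whereas
  \<open>I - A = - h \<beta> G F = - h F (\<beta> G)\<close>. Multiplying the latter on the right by the inverse of the former
  leaves \<open>- h F\<close>.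
\<close>

text \<open>
  If the columns of \<open>A\<close> span the whole space, only the zero vector is orthogonal to all of them.
  Spans can be avoided: a maximal independent set of columns has \<open>n\<close> elements, so it forms a square
  matrix \<open>B\<close> of nonzero determinant, and the transpose of \<open>B\<close> kills \<open>v\<close> as well.
\<close>

lemma (in vec_space) full_row_rank_kernel_transpose:
  assumes A: "A \<in> carrier_mat n nc" and rank: "rank A = n"
    and v: "v \<in> carrier_vec n" and zero: "transpose_mat A *\<^sub>v v = 0\<^sub>v nc"
  shows "v = 0\<^sub>v n"
proof -
  have orth: "c \<bullet> v = 0" if "c \<in> set (cols A)" for c
  proof -
    from that A obtain j where j: "j < nc" "c = col A j" by (auto simp: cols_def)
    have "(transpose_mat A *\<^sub>v v) $ j = c \<bullet> v" using A j by simp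
    with zero j show ?thesis by simp
  qed
  have "lin_indpt {}"
    by (simp add: lin_dep_def)
  then obtain U where U: "finite U" "maximal U (\<lambda>T. T \<subseteq> set (cols A) \<and> lin_indpt T)"
    using maximal_exists_superset[of "set (cols A)" "\<lambda>T. T \<subseteq> set (cols A) \<and> lin_indpt T" "{}"]
    by auto
  then have U_cols: "U \<subseteq> set (cols A)" and indpt: "lin_indpt U" and card: "card U = n"
    using rank_card_indpt[OF A U(2)] rank by (auto simp: maximal_def)
  have U_carrier: "U \<subseteq> carrier_vec n" using U_cols cols_dim[of A] A by auto
  obtain us where us: "set us = U" "distinct us" "length us = n"
    using finite_distinct_list[OF U(1)] card distinct_card by metis
  define B where "B = mat_of_cols n us"
  have B: "B \<in> carrier_mat n n" and cols_B: "cols B = us"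
    using us U_carrier by (auto simp: B_def intro: cols_mat_of_cols)
  have "rank B = n" using lin_indpt_full_rank[OF B] us indpt by (simp add: cols_B)
  then have "det (transpose_mat B) \<noteq> 0" using det_rank_iff[OF B] det_transpose[OF B] by simp
  moreover have "transpose_mat B *\<^sub>v v = 0\<^sub>v n"
  proof (rule eq_vecI)
    fix i assume i: "i < dim_vec (0\<^sub>v n :: 'a vec)"
    have "(transpose_mat B *\<^sub>v v) $ i = us ! i \<bullet> v"
      using B i us cols_nth[of i B] by (simp add: cols_B)
    also have "\<dots> = 0" using i us U_cols by (intro orth) auto
    finally show "(transpose_mat B *\<^sub>v v) $ i = (0\<^sub>v n :: 'a vec) $ i" using i by simp
  qed (use B in simp)
  ultimately show ?thesis
    using det_0_iff_vec_prod_zero_field[of "transpose_mat B" n] B v by auto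
qed

lemma real_scalar_prod_self_eq_0:
  fixes v :: "real vec"
  assumes "v \<bullet> v = 0"
  shows "v = 0\<^sub>v (dim_vec v)"
  using assms by (intro eq_vecI) (auto simp: scalar_prod_def sum_nonneg_eq_0_iff)

lemma invertible_mat_if_det_nonzero:
  fixes A :: "'a :: field mat"
  assumes A: "A \<in> carrier_mat n n" and det: "det A \<noteq> 0"
  shows "invertible_mat A"
proof -
  obtain B where "B \<in> carrier_mat n n" "A * B = 1\<^sub>m n" "B * A = 1\<^sub>m n"
    using det_non_zero_imp_unit[OF A det, of "()"] by (auto simp: Units_def ring_mat_def)
  then show ?thesis
    using A unfolding invertible_mat_def inverts_mat_def by (intro conjI exI[of _ B]) auto
qed

text \<open>
  The Gram matrix \<open>X X\<^sup>T\<close> has the same kernel as \<open>X\<^sup>T\<close>: if \<open>X X\<^sup>T v = 0\<close>, then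
  \<open>X\<^sup>T v \<bullet> X\<^sup>T v = v \<bullet> X X\<^sup>T v = 0\<close>, and a real vector orthogonal to itself vanishes.
\<close>

lemma invertible_gram_matrix:
  fixes X :: "real mat"
  assumes X: "X \<in> carrier_mat n m" and rank: "vec_space.rank n X = n"
  shows "invertible_mat (X * transpose_mat X)"
proof (rule invertible_mat_if_det_nonzero)
  show G: "X * transpose_mat X \<in> carrier_mat n n" using X by auto
  show "det (X * transpose_mat X) \<noteq> 0"
  proof
    assume "det (X * transpose_mat X) = 0"
    then obtain v where v: "v \<in> carrier_vec n" "v \<noteq> 0\<^sub>v n"
      and Gv: "(X * transpose_mat X) *\<^sub>v v = 0\<^sub>v n"
      using det_0_iff_vec_prod_zero_field[OF G] by auto
    define w where "w = transpose_mat X *\<^sub>v v"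
    have w: "w \<in> carrier_vec m" using X v by (auto simp: w_def)
    have "w \<bullet> w = v \<bullet> (X *\<^sub>v w)"
      using transpose_vec_mult_scalar[OF X w v(1)] by (simp add: w_def)
    also have "X *\<^sub>v w = 0\<^sub>v n"
      using Gv X v unfolding w_def by (subst assoc_mult_mat_vec[symmetric]) auto
    finally have "w = 0\<^sub>v m"
      using real_scalar_prod_self_eq_0[of w] v w by simp
    then show False
      using vec_space.full_row_rank_kernel_transpose[OF X rank v(1)] v by (simp add: w_def)
  qed
qed

lemma pseudoinverse_eqI:
  assumes "is_pseudoinverse A B"
  shows "pseudoinverse A = B"
  unfolding pseudoinverse_def using assms is_pseudoinverse_unique by (intro the_equality) auto

text \<open>
  The first three Penrose conditions follow from \<open>X\<^sup>T (X X\<^sup>T)\<^sup>-\<^sup>1\<close> being a right inverse of \<open>X\<close>; the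
  last one, the symmetry of \<open>X\<^sup>T (X X\<^sup>T)\<^sup>-\<^sup>1 X\<close>, holds because the inverse of a symmetric matrix is
  symmetric.
\<close>

lemma full_row_rank_is_pseudoinverse:
  assumes X: "X \<in> carrier_mat n m" and rank: "vec_space.rank n X = n"
  defines "H \<equiv> mat_inv (X * transpose_mat X)"
  shows "is_pseudoinverse X (transpose_mat X * H)" and "X * (transpose_mat X * H) = 1\<^sub>m n"
proof -
  let ?T = "transpose_mat X"
  define G where "G = X * ?T"
  have T: "?T \<in> carrier_mat m n" and G: "G \<in> carrier_mat n n" using X by (auto simp: G_def)
  have H: "H \<in> carrier_mat n n" and GH: "G * H = 1\<^sub>m n" and HG: "H * G = 1\<^sub>m n"
    using mat_inv[OF G] invertible_gram_matrix[OF X rank] by (auto simp: G_def H_def)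
  have G_sym: "transpose_mat G = G" using transpose_mult[OF X T] by (simp add: G_def)
  have "transpose_mat H = transpose_mat H * (G * H)" using GH H by simp
  also have "\<dots> = transpose_mat (G * H) * H"
    using transpose_mult[OF G H] G_sym assoc_mult_mat[of "transpose_mat H" n n G n H n] G H by simp
  also have "\<dots> = H" using GH H by simp
  finally have H_sym: "transpose_mat H = H" .
  have TH: "?T * H \<in> carrier_mat m n" using T H by auto
  show right_inv: "X * (?T * H) = 1\<^sub>m n"
    using assoc_mult_mat[OF X T H] GH by (simp add: G_def)
  have "?T * H * X * (?T * H) = ?T * H"
    using assoc_mult_mat[OF TH X TH] right_mult_one_mat[OF TH] by (simp add: right_inv)
  moreover have "transpose_mat (?T * H * X) = ?T * H * X"
    using transpose_mult[OF TH X] transpose_mult[OF T H] H_sym assoc_mult_mat[OF T H X] by simp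
  ultimately show "is_pseudoinverse X (?T * H)"
    using right_inv X TH by (simp add: is_pseudoinverse_def)
qed

lemma full_row_rank_mult_pseudoinverse:
  assumes X: "X \<in> carrier_mat n m" and rank: "vec_space.rank n X = n"
  shows "pseudoinverse X \<in> carrier_mat m n" and "X * pseudoinverse X = 1\<^sub>m n"
proof -
  note B = full_row_rank_is_pseudoinverse[OF X rank]
  note eq = pseudoinverse_eqI[OF B(1)]
  show "pseudoinverse X \<in> carrier_mat m n"
    using B(1) X unfolding eq by (auto simp: is_pseudoinverse_def)
  show "X * pseudoinverse X = 1\<^sub>m n" using B(2) unfolding eq .
qed

lemma shifted_data_matrix_eq_mult:
  assumes A: "A \<in> carrier_mat n n" and x: "\<And>i. i < m \<Longrightarrow> x i \<in> carrier_vec n"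
    and step: "\<And>i. i < m \<Longrightarrow> x (Suc i) = A *\<^sub>v x i"
  shows "shifted_data_matrix n m x = A * data_matrix n m x"
proof (rule eq_matI)
  fix i j assume "i < dim_row (A * data_matrix n m x)" "j < dim_col (A * data_matrix n m x)"
  then have i: "i < n" and j: "j < m" using A by (auto simp: data_matrix_def)
  have "col (data_matrix n m x) j = x j"
    using j x[OF j] by (simp add: data_matrix_def)
  then show "shifted_data_matrix n m x $$ (i, j) = (A * data_matrix n m x) $$ (i, j)"
    using A i j step[OF j] 
    by (simp add: shifted_data_matrix_def mat_of_cols_index data_matrix_def del: upt_Suc)
qed (use A in \<open>auto simp: shifted_data_matrix_def data_matrix_def\<close>)

lemma dmd_matrix_eq_one_step_matrix:
  assumes A: "A \<in> carrier_mat n n" and x0: "x 0 \<in> carrier_vec n"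
    and step: "\<And>i. i < m \<Longrightarrow> x (Suc i) = A *\<^sub>v x i"
    and rank: "vec_space.rank n (data_matrix n m x) = n"
  shows "dmd_matrix n m x = A"
proof -
  have X: "data_matrix n m x \<in> carrier_mat n m" by (auto simp: data_matrix_def)
  have x: "x i \<in> carrier_vec n" if "i < m" for i
    using that by (induction i) (use A x0 step in auto)
  note P = full_row_rank_mult_pseudoinverse[OF X rank]
  have "shifted_data_matrix n m x = A * data_matrix n m x"
    by (rule shifted_data_matrix_eq_mult[OF A]) (simp_all add: x step)
  then have "dmd_matrix n m x = A * (data_matrix n m x * pseudoinverse (data_matrix n m x))"
    using assoc_mult_mat[OF A X P(1)] by (simp add: dmd_matrix_def)
  then show ?thesis using P(2) A by simp
qed

text \<open>
  Both matrices in the reconstruction formula are expressed through the right factor \<open>\<beta> G\<close>. Keeping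
  \<open>\<beta>\<close> and \<open>G\<close> together spares a case distinction on \<open>\<beta> = 0\<close>.
\<close>

lemma rk1_matrix_identities:
  assumes F: "F \<in> carrier_mat n n"
    and inv: "invertible_mat (1\<^sub>m n - (h * \<alpha>) \<cdot>\<^sub>m F)"
  defines "G \<equiv> mat_inv (1\<^sub>m n - (h * \<alpha>) \<cdot>\<^sub>m F)"
  shows "rk1_matrix n h \<alpha> \<beta> F \<in> carrier_mat n n"
    and "\<alpha> \<cdot>\<^sub>m rk1_matrix n h \<alpha> \<beta> F + (\<beta> - \<alpha>) \<cdot>\<^sub>m 1\<^sub>m n = \<beta> \<cdot>\<^sub>m G"
    and "1\<^sub>m n - rk1_matrix n h \<alpha> \<beta> F = (- h) \<cdot>\<^sub>m (F * (\<beta> \<cdot>\<^sub>m G))"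
proof -
  define S where "S = 1\<^sub>m n - (h * \<alpha>) \<cdot>\<^sub>m F"
  have S: "S \<in> carrier_mat n n" using F by (auto simp: S_def)
  have G: "G \<in> carrier_mat n n" and SG: "S * G = 1\<^sub>m n" and GS: "G * S = 1\<^sub>m n"
    using mat_inv[OF S] inv by (auto simp: S_def G_def)
  have GF: "G * F \<in> carrier_mat n n" and FG: "F * G \<in> carrier_mat n n" using F G by auto
  have "G * S = G - (h * \<alpha>) \<cdot>\<^sub>m (G * F)"
    unfolding S_def using F G mult_smult_distrib[OF G F]
    by (subst mult_minus_distrib_mat[OF G, of _ n]) auto
  with GS have resolvent: "1\<^sub>m n = G - (h * \<alpha>) \<cdot>\<^sub>m (G * F)" by simp
  \<comment> \<open>\<open>G\<close> commutes with \<open>F\<close>: multiply \<open>F S = S F\<close> by \<open>G\<close> on both sides.\<close>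
  have "F * S = S * F"
    unfolding S_def using F mult_smult_distrib[OF F F] mult_smult_assoc_mat[OF F F]
    by (subst mult_minus_distrib_mat[OF F, of _ n], simp, simp,
        subst minus_mult_distrib_mat[of _ n n _ F n]) auto
  then have "G * (F * S) * G = G * (S * F) * G" by simp
  moreover have "G * (F * S) * G = G * F"
    using assoc_mult_mat[OF G F S] assoc_mult_mat[OF GF S G] right_mult_one_mat[OF GF]
    by (simp add: SG)
  moreover have "G * (S * F) * G = F * G"
    using assoc_mult_mat[OF G S F] GS F by simp
  ultimately have comm: "G * F = F * G" by simp
  have A: "rk1_matrix n h \<alpha> \<beta> F = 1\<^sub>m n + (h * \<beta>) \<cdot>\<^sub>m (G * F)"
    by (simp add: rk1_matrix_def G_def)
  show "rk1_matrix n h \<alpha> \<beta> F \<in> carrier_mat n n" using GF by (simp add: A)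
  \<comment> \<open>Entrywise, the remaining claims are scalar identities once every entry of \<open>I\<close> is rewritten by
    the resolvent identity.\<close>
  have entry: "(1\<^sub>m n :: real mat) $$ (i, j) = G $$ (i, j) - h * \<alpha> * (G * F) $$ (i, j)"
    if "i < n" "j < n" for i j
    using that F G by (subst resolvent) (simp del: index_mult_mat(1))
  show "\<alpha> \<cdot>\<^sub>m rk1_matrix n h \<alpha> \<beta> F + (\<beta> - \<alpha>) \<cdot>\<^sub>m 1\<^sub>m n = \<beta> \<cdot>\<^sub>m G"
    unfolding A using GF G F
    by (intro eq_matI)
      (simp_all add: entry algebra_simps del: index_mult_mat(1) index_one_mat(1))
  show "1\<^sub>m n - rk1_matrix n h \<alpha> \<beta> F = (- h) \<cdot>\<^sub>m (F * (\<beta> \<cdot>\<^sub>m G))"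
    unfolding A mult_smult_distrib[OF F G] comm using FG F G
    by (intro eq_matI) (simp_all add: algebra_simps del: index_mult_mat(1) index_one_mat(1))
qed

theorem lemma3p11:
  fixes n m :: nat and F :: "real mat" and x :: "nat \<Rightarrow> real vec" and \<alpha> \<beta> h :: real
  assumes F: "F \<in> carrier_mat n n"
    and x0: "x 0 \<in> carrier_vec n"
    and h: "h > 0"
    and nonsingular: "invertible_mat (1\<^sub>m n - (h * \<alpha>) \<cdot>\<^sub>m F)"
    and step: "\<forall>i<m. x (Suc i) = rk1_matrix n h \<alpha> \<beta> F *\<^sub>v x i"
    and rank: "vec_space.rank n (data_matrix n m x) = n"
    and inverse_exists:
      "invertible_mat (\<alpha> \<cdot>\<^sub>m dmd_matrix n m x + (\<beta> - \<alpha>) \<cdot>\<^sub>m 1\<^sub>m n)"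
  shows "F = (- (1 / h)) \<cdot>\<^sub>m
    ((1\<^sub>m n - dmd_matrix n m x) *
      mat_inv (\<alpha> \<cdot>\<^sub>m dmd_matrix n m x + (\<beta> - \<alpha>) \<cdot>\<^sub>m 1\<^sub>m n))"
proof -
  note rk1 = rk1_matrix_identities[OF F nonsingular, of \<beta>]
  have dmd: "dmd_matrix n m x = rk1_matrix n h \<alpha> \<beta> F"
    using dmd_matrix_eq_one_step_matrix[OF rk1(1) x0 _ rank] step by blast
  define M where "M = \<alpha> \<cdot>\<^sub>m dmd_matrix n m x + (\<beta> - \<alpha>) \<cdot>\<^sub>m 1\<^sub>m n"
  have M: "M \<in> carrier_mat n n" using rk1(1) by (simp add: M_def dmd)
  note N = mat_inv[OF M inverse_exists[folded M_def]]
  have "1\<^sub>m n - dmd_matrix n m x = (- h) \<cdot>\<^sub>m (F * M)"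
    unfolding M_def dmd rk1(2) by (rule rk1(3))
  then have "(1\<^sub>m n - dmd_matrix n m x) * mat_inv M = (- h) \<cdot>\<^sub>m (F * M * mat_inv M)"
    using F M N(1) mult_smult_assoc_mat[of "F * M" n n "mat_inv M" n "- h"] by simp
  also have "F * M * mat_inv M = F"
    using assoc_mult_mat[OF F M N(1)] N(2) F by simp
  finally show ?thesis using h F by (intro eq_matI) (auto simp: M_def)
qed

end
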